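(* Let $L\subseteq\mathsf H^\circ$ satisfy $0\in\overline L$ (equivalently, there is a sequence $\ell_n\in L$ with $\ell_n\to0$; the case $0\in L$ is included). Let $\{\Phi_t\}_{t\ge0}$ be nonempty-valued maps $\Phi_t:\Delta_m^\circ\rightrightarrows\Delta_m^\circ$ such that every $\Psi_t(x):=\operatorname{clr}(\Phi_t(\operatorname{softmax}x))$ is nonempty compact-valued and Hausdorff-continuous on $\mathsf H^\circ$. (1) The family is $L$-compatible if and only if there is a unique Hausdorff-continuous (nonempty) compact-valued map $\mathcal C:\mathsf H^\circ/G_L\rightrightarrows\mathsf H^\circ$ such that $$\Psi_t(x)=x+\mathcal C(\pi_Lx)\qquad\forall t\ge0,\ x\in\mathsf H^\circ .$$ (2) Suppose the family is $L$-compatible and let $\mathcal A\subseteq\mathsf H^\circ$ be a set of consistency anchors for it, i.e. for each $x^\star\in\mathcal A$ there is a sequence $x_t\to x^\star$ with $d_{H,*}(\Psi_t(x_t),\{x^\star\})\to0$ as $t\to\infty$. Then $\mathcal C(\pi_Lx^\star)=\{0\}$ for every $x^\star\in\mathcal A$. (3) For a given set $\mathcal A\subseteq\mathsf H^\circ$, the anchor condition on $\mathcal A$ forces every such continuous $L$-compatible family to be the singleton constructor (that is, every $L$-compatible family with nonempty compact-valued Hausdorff-continuous $\Psi_t$, for which every point of $\mathcal A$ is a consistency anchor, satisfies $\Psi_t(x)=\{x\}$ for all $t\ge 0$ and $x\in\mathsf H^\circ$) if and only if $$\overline{\pi_L(\mathcal A)}=\mathsf H^\circ/G_L .$$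
   Context: Fix $m\ge2$. $\Delta_m^\circ$ is the set of strictly positive probability vectors in $\mathbb R^m$. $\mathsf H^\circ:=\{x\in\mathbb R^m:\sum_ix_i=0\}$. The centered log-ratio map $\operatorname{clr}:\Delta_m^\circ\to\mathsf H^\circ$, $\operatorname{clr}(p)_i=\log p_i-\frac1m\sum_j\log p_j$, is a bijection with inverse $\operatorname{softmax}(x)=(e^{x_i}/\sum_ke^{x_k})_i$. For a set $A$, $\operatorname{clr}(A)$ is its image; $x+A$ is the translate. For $L\subseteq\mathsf H^\circ$ (admissible centered log-likelihood increments), $\Gamma(L)$ is the additive subgroup of $\mathsf H^\circ$ generated by $L$ (with $\Gamma(\varnothing)=\{0\}$), $G_L:=\overline{\Gamma(L)}$, and $\pi_L:\mathsf H^\circ\to\mathsf H^\circ/G_L$ is the quotient map; $\mathsf H^\circ/G_L$ carries the quotient topology (equivalently, the metric $d(\pi_Lx,\pi_Ly)=\inf_{g\in G_L}\|x-y-g\|_*$). Here $\|\cdot\|_*$ is a fixed norm on $\mathsf H^\circ$, and $d_{H,*}$ is the induced Hausdorff metric on nonempty compact subsets of $\mathsf H^\circ$; Hausdorff continuity of compact-valued maps is with respect to it. The family $\{\Phi_t\}_{t\ge0}$ is $L$-compatible if $\Psi_{t+1}(x+\ell)=\Psi_t(x)+\ell$ for all $t\ge0$, $x\in\mathsf H^\circ$, $\ell\in L$. *)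

theory Defs
  imports "HOL-Analysis.Analysis" "HOL-Computational_Algebra.Group_Closure"
begin

text \<open>
  Vectors of \<open>R^m\<close> are elements of \<open>real ^ 'n\<close> with \<open>m = CARD('n)\<close>; time is discrete.
\<close>

definition open_simplex :: "(real ^ 'n) set" where
  "open_simplex = {p. (\<forall>i. 0 < p $ i) \<and> (\<Sum>i\<in>UNIV. p $ i) = 1}"

definition H0 :: "(real ^ 'n) set" where
  "H0 = {x. (\<Sum>i\<in>UNIV. x $ i) = 0}"

definition clr :: "real ^ 'n \<Rightarrow> real ^ 'n" where
  "clr p = (\<chi> i. ln (p $ i) - (\<Sum>j\<in>UNIV. ln (p $ j)) / real CARD('n))"

definition softmax :: "real ^ 'n \<Rightarrow> real ^ 'n" where
  "softmax x = (\<chi> i. exp (x $ i) / (\<Sum>k\<in>UNIV. exp (x $ k)))"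


subsection \<open>The Hausdorff metric induced by a norm on \<open>H0\<close>\<close>

definition norm_on :: "'a::real_vector set \<Rightarrow> ('a \<Rightarrow> real) \<Rightarrow> bool" where
  "norm_on S \<nu> \<longleftrightarrow>
     (\<forall>x\<in>S. 0 \<le> \<nu> x) \<and>
     (\<forall>x\<in>S. \<nu> x = 0 \<longleftrightarrow> x = 0) \<and>
     (\<forall>x\<in>S. \<forall>c. \<nu> (c *\<^sub>R x) = \<bar>c\<bar> * \<nu> x) \<and>
     (\<forall>x\<in>S. \<forall>y\<in>S. \<nu> (x + y) \<le> \<nu> x + \<nu> y)"

text \<open>
  Since \<open>H0\<close> is finite-dimensional and closed in \<open>real ^ 'n\<close>, compactness, closures and
  convergence in it are the Euclidean ones, whatever the norm \<open>\<nu>\<close> is.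
\<close>

definition compacts :: "(real ^ 'n) set set" where
  "compacts = {K. K \<subseteq> H0 \<and> K \<noteq> {} \<and> compact K}"

text \<open>
  The value outside \<open>compacts\<close> is a dummy: the locale \<open>Metric_space\<close> wants a distance that is
  nonnegative and symmetric on the whole type.
\<close>

definition hausdorff_dist ::
    "(real ^ 'n \<Rightarrow> real) \<Rightarrow> (real ^ 'n) set \<Rightarrow> (real ^ 'n) set \<Rightarrow> real" where
  "hausdorff_dist \<nu> A B =
     (if A \<in> compacts \<and> B \<in> compacts
      then max (SUP a\<in>A. INF b\<in>B. \<nu> (a - b)) (SUP b\<in>B. INF a\<in>A. \<nu> (a - b))
      else 0)"

lemma norm_on_H0_minus_commute:
  assumes "norm_on H0 \<nu>" "x \<in> H0" "y \<in> H0"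
  shows "\<nu> (x - y) = \<nu> (y - x)"
proof -
  have "x - y \<in> H0"
    using assms(2,3) by (simp add: H0_def sum_subtractf)
  then have "\<nu> ((-1) *\<^sub>R (x - y)) = \<bar>-1\<bar> * \<nu> (x - y)"
    using assms(1) unfolding norm_on_def by blast
  then show ?thesis by simp
qed

lemma norm_on_H0_le_norm:
  fixes \<nu> :: "real ^ 'n \<Rightarrow> real"
  assumes "norm_on H0 \<nu>"
  obtains M where "M \<ge> 0" "\<And>x. x \<in> H0 \<Longrightarrow> \<nu> x \<le> M * norm x"
proof -
  fix k :: 'n
  let ?v = "\<lambda>i. axis i 1 - axis k 1 :: real ^ 'n"
  have v: "?v i \<in> H0" for i
    by (simp add: H0_def sum_subtractf axis_def)
  have scale: "\<nu> (c *\<^sub>R x) = \<bar>c\<bar> * \<nu> x" if "x \<in> H0" for c x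
    using assms that unfolding norm_on_def by blast
  have nonneg: "0 \<le> \<nu> x" if "x \<in> H0" for x
    using assms that unfolding norm_on_def by blast
  have tri: "\<nu> (x + y) \<le> \<nu> x + \<nu> y" if "x \<in> H0" "y \<in> H0" for x y
    using assms that unfolding norm_on_def by blast
  have zero: "\<nu> 0 = 0" "(0 :: real ^ 'n) \<in> H0"
    using assms unfolding norm_on_def H0_def by auto
  have scale_mem: "c *\<^sub>R x \<in> H0" if "x \<in> H0" for c and x :: "real ^ 'n"
    using that by (simp add: H0_def flip: sum_distrib_left)
  have add_mem: "x + y \<in> H0" if "x \<in> H0" "y \<in> H0" for x y :: "real ^ 'n"
    using that by (simp add: H0_def sum.distrib)
  have sums: "(\<Sum>i\<in>I. c i *\<^sub>R ?v i) \<in> H0 \<and>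
      \<nu> (\<Sum>i\<in>I. c i *\<^sub>R ?v i) \<le> (\<Sum>i\<in>I. \<bar>c i\<bar> * \<nu> (?v i))" if "finite I" for c I
    using that
  proof (induction I)
    case empty
    then show ?case by (simp add: zero)
  next
    case (insert i I)
    let ?s = "\<Sum>i\<in>I. c i *\<^sub>R ?v i"
    have "\<nu> (c i *\<^sub>R ?v i + ?s) \<le> \<nu> (c i *\<^sub>R ?v i) + \<nu> ?s"
      using insert.IH v scale_mem by (intro tri) auto
    also have "\<dots> \<le> \<bar>c i\<bar> * \<nu> (?v i) + (\<Sum>i\<in>I. \<bar>c i\<bar> * \<nu> (?v i))"
      using insert.IH scale[OF v] by simp
    finally show ?case
      using insert add_mem[OF scale_mem[OF v]] by simp
  qed
  show thesis
  proof
    show "(\<Sum>i\<in>UNIV. \<nu> (?v i)) \<ge> 0"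
      by (intro sum_nonneg nonneg v)
  next
    fix x :: "real ^ 'n"
    assume x: "x \<in> H0"
    have "(\<Sum>i\<in>UNIV. x $ i *\<^sub>R ?v i)
        = (\<Sum>i\<in>UNIV. x $ i *\<^sub>R axis i 1) - (\<Sum>i\<in>UNIV. x $ i) *\<^sub>R axis k 1"
      by (simp only: scaleR_diff_right sum_subtractf scaleR_sum_left)
    also have "\<dots> = x"
      using x by (simp add: H0_def vec_eq_iff axis_def if_distrib cong: if_cong)
    finally have "\<nu> x = \<nu> (\<Sum>i\<in>UNIV. x $ i *\<^sub>R ?v i)" by simp
    also have "\<dots> \<le> (\<Sum>i\<in>UNIV. \<bar>x $ i\<bar> * \<nu> (?v i))"
      using sums[of UNIV "\<lambda>i. x $ i"] by simp
    also have "\<dots> \<le> (\<Sum>i\<in>UNIV. norm x * \<nu> (?v i))"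
      by (intro sum_mono mult_right_mono component_le_norm_cart nonneg v)
    finally show "\<nu> x \<le> (\<Sum>i\<in>UNIV. \<nu> (?v i)) * norm x"
      by (simp add: sum_distrib_left mult.commute)
  qed
qed

lemma hausdorff_dist_le_iff:
  assumes N: "norm_on H0 \<nu>" and A: "A \<in> compacts" and B: "B \<in> compacts"
  shows "hausdorff_dist \<nu> A B \<le> r \<longleftrightarrow>
    (\<forall>a\<in>A. \<exists>b\<in>B. \<nu> (a - b) \<le> r) \<and> (\<forall>b\<in>B. \<exists>a\<in>A. \<nu> (b - a) \<le> r)"
proof -
  obtain M where M: "M \<ge> 0" "\<And>x. x \<in> H0 \<Longrightarrow> \<nu> x \<le> M * norm x"
    using norm_on_H0_le_norm[OF N] by blast
  have diff: "x - y \<in> H0" if "x \<in> H0" "y \<in> H0" for x y :: "real ^ 'n"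
    using that by (simp add: H0_def sum_subtractf)
  have nonneg: "0 \<le> \<nu> (x - y)" if "x \<in> H0" "y \<in> H0" for x y
    using N diff[OF that] unfolding norm_on_def by blast
  have tri: "\<nu> (x - z) \<le> \<nu> (x - y) + \<nu> (y - z)" if "x \<in> H0" "y \<in> H0" "z \<in> H0" for x y z
  proof -
    have "\<nu> ((x - y) + (y - z)) \<le> \<nu> (x - y) + \<nu> (y - z)"
      using N diff that unfolding norm_on_def by blast
    then show ?thesis by simp
  qed
  have one_side: "(SUP a\<in>S. INF b\<in>T. \<nu> (a - b)) \<le> r \<longleftrightarrow> (\<forall>a\<in>S. \<exists>b\<in>T. \<nu> (a - b) \<le> r)"
    if S: "S \<in> compacts" and T: "T \<in> compacts" for S T
  proof -
    have ST: "S \<subseteq> H0" "T \<subseteq> H0" "S \<noteq> {}" "T \<noteq> {}" "compact S" "compact T"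
      using S T by (auto simp: compacts_def)
    have bdd: "bdd_below ((\<lambda>b. \<nu> (a - b)) ` T)" if "a \<in> S" for a
      using nonneg that ST by (intro bdd_belowI2[of _ 0]) auto
    have cont: "continuous_on T (\<lambda>b. \<nu> (a - b))" if "a \<in> S" for a
    proof (rule continuous_on_iff[THEN iffD2], intro ballI allI impI)
      fix b e :: _ assume b: "b \<in> T" and e: "0 < (e::real)"
      have "dist (\<nu> (a - b')) (\<nu> (a - b)) < e" if b': "b' \<in> T" and "dist b' b < e / (M + 1)" for b'
      proof -
        have mem: "a \<in> H0" "b \<in> H0" "b' \<in> H0" using ST b b' \<open>a \<in> S\<close> by auto
        have "\<bar>\<nu> (a - b') - \<nu> (a - b)\<bar> \<le> \<nu> (b' - b)"
          using tri[of a b b'] tri[of a b' b] norm_on_H0_minus_commute[OF N, of b b'] mem by simp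
        also have "\<dots> \<le> M * dist b' b"
          using M(2)[OF diff] mem by (simp add: dist_norm)
        also have "\<dots> \<le> (M + 1) * dist b' b" by (simp add: distrib_right)
        also have "\<dots> < e"
          using that M(1) by (simp add: field_simps)
        finally show ?thesis by (simp add: dist_real_def)
      qed
      then show "\<exists>d>0. \<forall>b'\<in>T. dist b' b < d \<longrightarrow> dist (\<nu> (a - b')) (\<nu> (a - b)) < e"
        using e M(1) by (intro exI[of _ "e / (M + 1)"]) auto
    qed
    have inf: "(INF b\<in>T. \<nu> (a - b)) \<le> r \<longleftrightarrow> (\<exists>b\<in>T. \<nu> (a - b) \<le> r)" if a: "a \<in> S" for a
    proof
      assume le: "(INF b\<in>T. \<nu> (a - b)) \<le> r"
      obtain b where b: "b \<in> T" "\<And>y. y \<in> T \<Longrightarrow> \<nu> (a - b) \<le> \<nu> (a - y)"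
        using continuous_attains_inf[OF \<open>compact T\<close> \<open>T \<noteq> {}\<close> cont[OF a]] by blast
      have "\<nu> (a - b) \<le> (INF b\<in>T. \<nu> (a - b))"
        using b ST by (intro cINF_greatest) auto
      then show "\<exists>b\<in>T. \<nu> (a - b) \<le> r" using le b(1) by (meson order_trans)
    next
      assume "\<exists>b\<in>T. \<nu> (a - b) \<le> r"
      then show "(INF b\<in>T. \<nu> (a - b)) \<le> r"
        using bdd[OF a] by (meson cINF_lower2)
    qed
    obtain b0 where b0: "b0 \<in> T" using ST by blast
    obtain R where R: "\<And>a. a \<in> S \<Longrightarrow> norm a \<le> R"
      using \<open>compact S\<close> compact_imp_bounded bounded_iff by metis
    have "bdd_above ((\<lambda>a. INF b\<in>T. \<nu> (a - b)) ` S)"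
    proof (rule bdd_aboveI2)
      fix a assume a: "a \<in> S"
      have "(INF b\<in>T. \<nu> (a - b)) \<le> \<nu> (a - b0)"
        using bdd[OF a] b0 by (rule cINF_lower)
      also have "\<dots> \<le> M * norm (a - b0)"
        using a b0 ST by (intro M(2) diff) auto
      also have "\<dots> \<le> M * (R + norm b0)"
        using M(1) R[OF a] norm_triangle_ineq4[of a b0] by (intro mult_left_mono) auto
      finally show "(INF b\<in>T. \<nu> (a - b)) \<le> M * (R + norm b0)" .
    qed
    then show ?thesis
      using ST inf by (simp add: cSUP_le_iff)
  qed
  have "\<nu> (a - b) = \<nu> (b - a)" if "a \<in> A" "b \<in> B" for a b
    using that A B by (intro norm_on_H0_minus_commute[OF N]) (auto simp: compacts_def)
  then have "(SUP b\<in>B. INF a\<in>A. \<nu> (a - b)) = (SUP b\<in>B. INF a\<in>A. \<nu> (b - a))"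
    by (intro SUP_cong INF_cong refl) auto
  then show ?thesis
    using A B one_side by (simp add: hausdorff_dist_def)
qed

lemma Metric_space_hausdorff_dist:
  fixes \<nu> :: "real ^ 'n \<Rightarrow> real"
  assumes N: "norm_on H0 \<nu>"
  shows "Metric_space compacts (hausdorff_dist \<nu>)"
proof -
  have diff: "x - y \<in> H0" if "x \<in> H0" "y \<in> H0" for x y :: "real ^ 'n"
    using that by (simp add: H0_def sum_subtractf)
  have nonneg: "0 \<le> \<nu> (x - y)" if "x \<in> H0" "y \<in> H0" for x y
    using N diff[OF that] unfolding norm_on_def by blast
  have eq0: "x = y" if "\<nu> (x - y) \<le> 0" "x \<in> H0" "y \<in> H0" for x y
  proof -
    have "\<nu> (x - y) = 0" using nonneg that by (simp add: antisym)
    then have "x - y = 0" using N diff that(2,3) unfolding norm_on_def by blast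
    then show ?thesis by simp
  qed
  have tri: "\<nu> (x - z) \<le> \<nu> (x - y) + \<nu> (y - z)" if "x \<in> H0" "y \<in> H0" "z \<in> H0" for x y z
  proof -
    have "\<nu> ((x - y) + (y - z)) \<le> \<nu> (x - y) + \<nu> (y - z)"
      using N diff that unfolding norm_on_def by blast
    then show ?thesis by simp
  qed
  have nu0: "\<nu> 0 = 0"
    using N unfolding norm_on_def H0_def by auto
  have sub: "a \<in> H0" if "a \<in> A" "A \<in> compacts" for a A
    using that by (auto simp: compacts_def)
  note le_iff = hausdorff_dist_le_iff[OF N]
  have dnn: "0 \<le> hausdorff_dist \<nu> A B" for A B
  proof (cases "A \<in> compacts \<and> B \<in> compacts")
    case True
    then obtain a where a: "a \<in> A" by (auto simp: compacts_def)
    then obtain b where "b \<in> B" "\<nu> (a - b) \<le> hausdorff_dist \<nu> A B"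
      using le_iff[of A B "hausdorff_dist \<nu> A B"] True by auto
    then show ?thesis using nonneg[of a b] a True sub by fastforce
  qed (auto simp: hausdorff_dist_def)
  show ?thesis
  proof
    show "0 \<le> hausdorff_dist \<nu> A B" for A B by (rule dnn)
    show "hausdorff_dist \<nu> A B = hausdorff_dist \<nu> B A" for A B
    proof (cases "A \<in> compacts \<and> B \<in> compacts")
      case True
      then have "hausdorff_dist \<nu> A B \<le> r \<longleftrightarrow> hausdorff_dist \<nu> B A \<le> r" for r
        using le_iff[of A B r] le_iff[of B A r] by auto
      then show ?thesis by (meson antisym order_refl)
    qed (auto simp: hausdorff_dist_def)
  next
    fix A B :: "(real ^ 'n) set"
    assume A: "A \<in> compacts" and B: "B \<in> compacts"
    have "hausdorff_dist \<nu> A B = 0 \<longleftrightarrow> hausdorff_dist \<nu> A B \<le> 0"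
      using dnn[of A B] by auto
    also have "\<dots> \<longleftrightarrow> A = B"
    proof
      assume "hausdorff_dist \<nu> A B \<le> 0"
      then have "\<forall>a\<in>A. \<exists>b\<in>B. \<nu> (a - b) \<le> 0" "\<forall>b\<in>B. \<exists>a\<in>A. \<nu> (b - a) \<le> 0"
        using le_iff[OF A B] by auto
      then show "A = B" using eq0 sub A B by (metis subsetI subset_antisym)
    next
      assume "A = B"
      moreover have "\<exists>b\<in>A. \<nu> (a - b) \<le> 0" if "a \<in> A" for a
        using that nu0 by (intro bexI[of _ a]) auto
      ultimately show "hausdorff_dist \<nu> A B \<le> 0" using le_iff[OF A B] by blast
    qed
    finally show "hausdorff_dist \<nu> A B = 0 \<longleftrightarrow> A = B" .
  next
    fix A B C :: "(real ^ 'n) set"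
    assume A: "A \<in> compacts" and B: "B \<in> compacts" and C: "C \<in> compacts"
    let ?r = "hausdorff_dist \<nu> A B" and ?s = "hausdorff_dist \<nu> B C"
    have AB: "\<forall>a\<in>A. \<exists>b\<in>B. \<nu> (a - b) \<le> ?r" "\<forall>b\<in>B. \<exists>a\<in>A. \<nu> (b - a) \<le> ?r"
      using le_iff[OF A B, of ?r] by auto
    have BC: "\<forall>b\<in>B. \<exists>c\<in>C. \<nu> (b - c) \<le> ?s" "\<forall>c\<in>C. \<exists>b\<in>B. \<nu> (c - b) \<le> ?s"
      using le_iff[OF B C, of ?s] by auto
    have "\<exists>c\<in>C. \<nu> (a - c) \<le> ?r + ?s" if a: "a \<in> A" for a
    proof -
      obtain b where b: "b \<in> B" "\<nu> (a - b) \<le> ?r" using AB a by blast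
      obtain c where c: "c \<in> C" "\<nu> (b - c) \<le> ?s" using BC b by blast
      show ?thesis
        using tri[OF sub[OF a A] sub[OF b(1) B] sub[OF c(1) C]] b(2) c by (intro bexI[of _ c]) auto
    qed
    moreover have "\<exists>a\<in>A. \<nu> (c - a) \<le> ?r + ?s" if c: "c \<in> C" for c
    proof -
      obtain b where b: "b \<in> B" "\<nu> (c - b) \<le> ?s" using BC c by blast
      obtain a where a: "a \<in> A" "\<nu> (b - a) \<le> ?r" using AB b by blast
      show ?thesis
        using tri[OF sub[OF c C] sub[OF b(1) B] sub[OF a(1) A]] b(2) a by (intro bexI[of _ a]) auto
    qed
    ultimately show "hausdorff_dist \<nu> A C \<le> ?r + ?s"
      using le_iff[OF A C] by blast
  qed
qed

definition hausdorff_topology :: "(real ^ 'n \<Rightarrow> real) \<Rightarrow> (real ^ 'n) set topology" where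
  "hausdorff_topology \<nu> = Metric_space.mtopology compacts (hausdorff_dist \<nu>)"


subsection \<open>The quotient of \<open>H0\<close> by the closed subgroup generated by \<open>L\<close>\<close>

definition closed_group :: "(real ^ 'n) set \<Rightarrow> (real ^ 'n) set" where
  "closed_group L = closure (group_closure L)"

text \<open>Points of the quotient are cosets.\<close>

definition quot_proj :: "(real ^ 'n) set \<Rightarrow> real ^ 'n \<Rightarrow> (real ^ 'n) set" where
  "quot_proj L x = (\<lambda>g. x + g) ` closed_group L"

definition quot_topology :: "(real ^ 'n) set \<Rightarrow> (real ^ 'n) set topology" where
  "quot_topology L =
     topology (\<lambda>U. U \<subseteq> quot_proj L ` H0 \<and>
                   openin (top_of_set H0) {x \<in> H0. quot_proj L x \<in> U})"

lemma openin_quot_topology: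
  "openin (quot_topology L) U \<longleftrightarrow>
     U \<subseteq> quot_proj L ` H0 \<and> openin (top_of_set H0) {x \<in> H0. quot_proj L x \<in> U}"
proof -
  have "istopology (\<lambda>U. U \<subseteq> quot_proj L ` H0 \<and>
                        openin (top_of_set H0) {x \<in> H0. quot_proj L x \<in> U})"
    unfolding istopology_def
  proof (intro conjI allI impI; (elim conjE)?)
    fix S T
    assume "openin (top_of_set H0) {x \<in> H0. quot_proj L x \<in> S}"
      and "openin (top_of_set H0) {x \<in> H0. quot_proj L x \<in> T}"
    then have "openin (top_of_set H0)
        ({x \<in> H0. quot_proj L x \<in> S} \<inter> {x \<in> H0. quot_proj L x \<in> T})"
      by (rule openin_Int)
    also have "{x \<in> H0. quot_proj L x \<in> S} \<inter> {x \<in> H0. quot_proj L x \<in> T}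
        = {x \<in> H0. quot_proj L x \<in> S \<inter> T}" by auto
    finally show "openin (top_of_set H0) {x \<in> H0. quot_proj L x \<in> S \<inter> T}" .
  next
    fix \<K>
    assume *: "\<forall>K\<in>\<K>. K \<subseteq> quot_proj L ` H0 \<and>
        openin (top_of_set H0) {x \<in> H0. quot_proj L x \<in> K}"
    have "openin (top_of_set H0) (\<Union>K\<in>\<K>. {x \<in> H0. quot_proj L x \<in> K})"
      using * by blast
    also have "(\<Union>K\<in>\<K>. {x \<in> H0. quot_proj L x \<in> K}) = {x \<in> H0. quot_proj L x \<in> \<Union>\<K>}"
      by auto
    finally show "openin (top_of_set H0) {x \<in> H0. quot_proj L x \<in> \<Union>\<K>}" .
  qed auto
  then show ?thesis
    by (simp add: quot_topology_def topology_inverse')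
qed

lemma topspace_quot_topology: "topspace (quot_topology L) = quot_proj L ` H0"
proof
  show "topspace (quot_topology L) \<subseteq> quot_proj L ` H0"
    using openin_quot_topology openin_topspace by blast
  have "{x \<in> H0. quot_proj L x \<in> quot_proj L ` H0} = H0" by auto
  then have "openin (quot_topology L) (quot_proj L ` H0)"
    by (simp add: openin_quot_topology)
  then show "quot_proj L ` H0 \<subseteq> topspace (quot_topology L)"
    by (rule openin_subset)
qed

lemma quotient_map_quot_proj: "quotient_map (top_of_set H0) (quot_topology L) (quot_proj L)"
  by (simp add: quotient_map_def topspace_quot_topology openin_quot_topology)


subsection \<open>Families of set-valued updates\<close>

definition Psi ::
    "(nat \<Rightarrow> real ^ 'n \<Rightarrow> (real ^ 'n) set) \<Rightarrow> nat \<Rightarrow> real ^ 'n \<Rightarrow> (real ^ 'n) set" where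
  "Psi \<Phi> t x = clr ` \<Phi> t (softmax x)"

definition continuous_family ::
    "(real ^ 'n \<Rightarrow> real) \<Rightarrow> (nat \<Rightarrow> real ^ 'n \<Rightarrow> (real ^ 'n) set) \<Rightarrow> bool" where
  "continuous_family \<nu> \<Phi> \<longleftrightarrow>
     (\<forall>t. \<forall>p\<in>open_simplex. \<Phi> t p \<noteq> {} \<and> \<Phi> t p \<subseteq> open_simplex) \<and>
     (\<forall>t. continuous_map (top_of_set H0) (hausdorff_topology \<nu>) (Psi \<Phi> t))"

definition compatible ::
    "(real ^ 'n) set \<Rightarrow> (nat \<Rightarrow> real ^ 'n \<Rightarrow> (real ^ 'n) set) \<Rightarrow> bool" where
  "compatible L \<Phi> \<longleftrightarrow>
     (\<forall>t. \<forall>x\<in>H0. \<forall>l\<in>L. Psi \<Phi> (Suc t) (x + l) = (\<lambda>y. y + l) ` Psi \<Phi> t x)"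

text \<open>
  The map \<open>C\<close> on the quotient is required to be \<open>extensional\<close> so that uniqueness of \<open>C\<close> as a
  HOL function means uniqueness on the quotient. Its values are nonempty compact subsets of
  \<open>H0\<close> because these are the points of \<open>hausdorff_topology \<nu>\<close>.
\<close>

definition represents ::
    "(real ^ 'n) set \<Rightarrow> (real ^ 'n \<Rightarrow> real) \<Rightarrow> (nat \<Rightarrow> real ^ 'n \<Rightarrow> (real ^ 'n) set) \<Rightarrow>
     ((real ^ 'n) set \<Rightarrow> (real ^ 'n) set) \<Rightarrow> bool" where
  "represents L \<nu> \<Phi> C \<longleftrightarrow>
     C \<in> extensional (quot_proj L ` H0) \<and>
     continuous_map (quot_topology L) (hausdorff_topology \<nu>) C \<and>
     (\<forall>t. \<forall>x\<in>H0. Psi \<Phi> t x = (\<lambda>c. x + c) ` C (quot_proj L x))"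

definition consistency_anchor ::
    "(real ^ 'n \<Rightarrow> real) \<Rightarrow> (nat \<Rightarrow> real ^ 'n \<Rightarrow> (real ^ 'n) set) \<Rightarrow> real ^ 'n \<Rightarrow> bool" where
  "consistency_anchor \<nu> \<Phi> a \<longleftrightarrow>
     (\<exists>X. (\<forall>t. X t \<in> H0) \<and> X \<longlonglongrightarrow> a \<and>
          (\<lambda>t. hausdorff_dist \<nu> (Psi \<Phi> t (X t)) {a}) \<longlonglongrightarrow> 0)"

end

theory Submission
  imports Defs
begin

text \<open>
  The residual \<open>E\<^sub>t(x) = \<Psi>\<^sub>t(x) - x\<close> is what compatibility constrains, and two continuous maps
  into a Hausdorff space that agree on a set agree on its closure. This rigidity is used three times.

  Compatibility says that \<open>l \<mapsto> \<Psi>\<^sub>t\<^sub>+\<^sub>1(x + l)\<close> and \<open>l \<mapsto> \<Psi>\<^sub>t(x) + l\<close> agree on \<open>L\<close>. Both are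
  continuous, so they agree at \<open>0\<close>, a point of the closure of \<open>L\<close>: hence \<open>\<Psi>\<^sub>t\<^sub>+\<^sub>1 = \<Psi>\<^sub>t\<close> and time
  disappears (\<open>Psi_time_independent\<close>). What is left of compatibility is that \<open>E\<close> has every
  element of \<open>L\<close> as a period. Periods form a group, and by rigidity a closed one, so \<open>E\<close> is
  constant on the cosets of the closed group generated by \<open>L\<close>
  (\<open>closed_group_period\<close>) and descends to a continuous map \<open>C\<close> on the quotient
  (\<open>compatible_imp_represents\<close>).

  At an anchor \<open>a\<close>, continuity turns the limit into \<open>\<Psi>\<^sub>0(a) = {a}\<close>, that is \<open>C(\<pi> a) = {0}\<close>. If the
  images of the anchors are dense in the quotient, rigidity propagates \<open>C = {0}\<close> everywhere. If they
  are not dense, some coset \<open>x\<^sub>0 + G\<close> keeps a positive distance \<open>r\<close> from all anchors, and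
  \<open>\<Psi>(x) = {x + f(x) v}\<close> with the \<open>G\<close>-periodic bump \<open>f(x) = max 0 (r - dist(x, x\<^sub>0 + G))\<close> and a
  nonzero direction \<open>v\<close> is a compatible family that fixes every anchor and moves \<open>x\<^sub>0\<close>
  (\<open>nontrivial_family_off_closure\<close>).
\<close>

section \<open>Zero-sum vectors and the centered log-ratio\<close>

lemma H0_zero: "(0 :: real ^ 'n) \<in> H0"
  by (simp add: H0_def)

lemma H0_add: "x \<in> H0 \<Longrightarrow> y \<in> H0 \<Longrightarrow> x + y \<in> H0"
  by (simp add: H0_def sum.distrib)

lemma H0_diff: "x \<in> H0 \<Longrightarrow> y \<in> H0 \<Longrightarrow> x - y \<in> H0"
  by (simp add: H0_def sum_subtractf)

lemma H0_uminus: "x \<in> H0 \<Longrightarrow> - x \<in> H0"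
  by (simp add: H0_def sum_negf)

lemma H0_scaleR: "x \<in> H0 \<Longrightarrow> c *\<^sub>R x \<in> H0"
  by (simp add: H0_def flip: sum_distrib_left)

lemma closed_H0: "closed (H0 :: (real ^ 'n) set)"
  unfolding H0_def by (intro closed_Collect_eq continuous_intros)

lemma H0_nonzero:
  assumes "CARD('n) \<ge> 2"
  obtains v :: "real ^ 'n" where "v \<in> H0" "v \<noteq> 0"
proof -
  obtain i j :: 'n where "i \<noteq> j"
    using assms card_le_Suc0_iff_eq[of "UNIV :: 'n set"] by fastforce
  show thesis
  proof
    show "axis i 1 - axis j (1::real) \<in> H0"
      by (simp add: H0_def sum_subtractf axis_def)
    show "axis i 1 - axis j (1::real) \<noteq> 0"
      using \<open>i \<noteq> j\<close> by (simp add: axis_eq_axis)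
  qed
qed

lemma sum_exp_pos: "(\<Sum>k\<in>UNIV. exp ((x :: real ^ 'n) $ k)) > 0"
  by (intro sum_pos) auto

lemma softmax_in_open_simplex: "softmax (x :: real ^ 'n) \<in> open_simplex"
  using sum_exp_pos[of x]
  by (simp add: open_simplex_def softmax_def flip: sum_divide_distrib)

lemma clr_softmax:
  fixes x :: "real ^ 'n"
  assumes "x \<in> H0"
  shows "clr (softmax x) = x"
proof -
  let ?S = "\<Sum>k\<in>UNIV. exp (x $ k)"
  have ln: "ln (softmax x $ i) = x $ i - ln ?S" for i
    using sum_exp_pos[of x] by (simp add: softmax_def ln_div)
  have "(\<Sum>i\<in>UNIV. x $ i) = 0"
    using assms by (simp add: H0_def)
  then show ?thesis
    by (simp add: clr_def ln vec_eq_iff sum_subtractf)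
qed

text \<open>
  Any update rule written in centered log-ratio coordinates comes from a family on the simplex;
  this lets examples be given by \<open>\<Psi>\<close> alone.
\<close>

lemma Psi_of_coordinates:
  fixes P :: "real ^ 'n \<Rightarrow> (real ^ 'n) set"
  assumes "x \<in> H0" "P x \<subseteq> H0"
  shows "Psi (\<lambda>t p. softmax ` P (clr p)) t x = P x"
proof -
  have "(\<lambda>y. clr (softmax y)) ` P x = (\<lambda>y. y) ` P x"
    using assms(2) by (intro image_cong) (auto simp: clr_softmax)
  then show ?thesis
    using assms(1) by (simp add: Psi_def clr_softmax image_image)
qed

section \<open>Translations in the Hausdorff metric\<close>

lemma compacts_translate:
  assumes "K \<in> compacts" "u \<in> H0"
  shows "(+) u ` K \<in> compacts"
  using assms by (auto simp: compacts_def H0_add subset_iff intro: compact_translation)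

lemma singleton_in_compacts: "x \<in> H0 \<Longrightarrow> {x} \<in> compacts"
  by (simp add: compacts_def)

lemma topspace_hausdorff_topology:
  "norm_on H0 \<nu> \<Longrightarrow> topspace (hausdorff_topology \<nu>) = compacts"
  by (simp add: hausdorff_topology_def Metric_space.topspace_mtopology Metric_space_hausdorff_dist)

lemma Hausdorff_space_hausdorff_topology:
  "norm_on H0 \<nu> \<Longrightarrow> Hausdorff_space (hausdorff_topology \<nu>)"
  by (simp add: hausdorff_topology_def Metric_space.Hausdorff_space_mtopology
      Metric_space_hausdorff_dist)

lemma continuous_map_into_hausdorff_topology:
  assumes N: "norm_on H0 \<nu>"
  shows "continuous_map X (hausdorff_topology \<nu>) F \<longleftrightarrow>
    F \<in> topspace X \<rightarrow> compacts \<and>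
    (\<forall>x\<in>topspace X. \<forall>e>0. \<exists>U. openin X U \<and> x \<in> U \<and> (\<forall>y\<in>U. hausdorff_dist \<nu> (F x) (F y) < e))"
proof -
  interpret Metric_space compacts "hausdorff_dist \<nu>"
    by (rule Metric_space_hausdorff_dist[OF N])
  have "F \<in> topspace X \<rightarrow> compacts" if "continuous_map X mtopology F"
    using continuous_map_funspace[OF that] by simp
  moreover have "F y \<in> compacts" if "F \<in> topspace X \<rightarrow> compacts" "openin X U" "y \<in> U" for y U
    using that openin_subset by blast
  ultimately show ?thesis
    unfolding hausdorff_topology_def continuous_map_to_metric in_mball by (smt (verit) PiE)
qed

lemma hausdorff_dist_translate_both_le:
  assumes N: "norm_on H0 \<nu>" and "A \<in> compacts" "B \<in> compacts" "u \<in> H0" "w \<in> H0"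
  shows "hausdorff_dist \<nu> ((+) u ` A) ((+) w ` B) \<le> hausdorff_dist \<nu> A B + \<nu> (u - w)"
proof -
  let ?r = "hausdorff_dist \<nu> A B"
  have AB: "\<forall>a\<in>A. \<exists>b\<in>B. \<nu> (a - b) \<le> ?r" "\<forall>b\<in>B. \<exists>a\<in>A. \<nu> (b - a) \<le> ?r"
    using hausdorff_dist_le_iff[OF N assms(2,3), of ?r] by auto
  have tri: "\<nu> ((u + a) - (w + b)) \<le> \<nu> (a - b) + \<nu> (u - w)"
    if "a \<in> H0" "b \<in> H0" "u \<in> H0" "w \<in> H0" for a b u w
  proof -
    have "\<nu> ((a - b) + (u - w)) \<le> \<nu> (a - b) + \<nu> (u - w)"
      using N that H0_diff unfolding norm_on_def by blast
    then show ?thesis by (simp add: algebra_simps)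
  qed
  have comm: "\<nu> (w - u) = \<nu> (u - w)"
    using norm_on_H0_minus_commute[OF N] assms(4,5) by blast
  have sub: "A \<subseteq> H0" "B \<subseteq> H0"
    using assms by (auto simp: compacts_def)
  have "\<exists>b\<in>B. \<nu> ((u + a) - (w + b)) \<le> ?r + \<nu> (u - w)" if a: "a \<in> A" for a
  proof -
    obtain b where b: "b \<in> B" "\<nu> (a - b) \<le> ?r" using AB(1) a by blast
    have "a \<in> H0" "b \<in> H0" using sub a b(1) by auto
    then have "\<nu> ((u + a) - (w + b)) \<le> ?r + \<nu> (u - w)"
      using tri[of a b u w] b(2) assms(4,5) by linarith
    then show ?thesis using b(1) by blast
  qed
  moreover have "\<exists>a\<in>A. \<nu> ((w + b) - (u + a)) \<le> ?r + \<nu> (u - w)" if b: "b \<in> B" for b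
  proof -
    obtain a where a: "a \<in> A" "\<nu> (b - a) \<le> ?r" using AB(2) b by blast
    have "a \<in> H0" "b \<in> H0" using sub b a(1) by auto
    then have "\<nu> ((w + b) - (u + a)) \<le> ?r + \<nu> (u - w)"
      using tri[of b a w u] a(2) assms(4,5) comm by linarith
    then show ?thesis using a(1) by blast
  qed
  ultimately show ?thesis
    by (subst hausdorff_dist_le_iff[OF N compacts_translate[OF assms(2,4)]
          compacts_translate[OF assms(3,5)]]) blast
qed

text \<open>
  Both \<open>\<Psi>\<close> and its residual are obtained from one another by a moving translation, so this is the
  only continuity computation that the results below need. The given norm is bounded by a
  multiple of the Euclidean one, hence a small Euclidean move is a small move of the set.
\<close>

lemma continuous_map_translate:
  fixes u :: "real ^ 'n \<Rightarrow> real ^ 'n" and \<nu> :: "real ^ 'n \<Rightarrow> real"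
  assumes N: "norm_on H0 \<nu>"
    and F: "continuous_map (top_of_set S) (hausdorff_topology \<nu>) F"
    and u: "continuous_on S u" "u \<in> S \<rightarrow> H0"
  shows "continuous_map (top_of_set S) (hausdorff_topology \<nu>) (\<lambda>x. (+) (u x) ` F x)"
proof -
  obtain M where M: "M \<ge> 0" "\<And>x. x \<in> H0 \<Longrightarrow> \<nu> x \<le> M * norm x"
    using norm_on_H0_le_norm[OF N] by blast
  have FC: "F x \<in> compacts" if "x \<in> S" for x
    using F that by (auto simp: continuous_map_into_hausdorff_topology[OF N])
  have uH: "u x \<in> H0" if "x \<in> S" for x
    using u that by auto
  have "\<exists>U. openin (top_of_set S) U \<and> x \<in> U \<and>
      (\<forall>y\<in>U. hausdorff_dist \<nu> ((+) (u x) ` F x) ((+) (u y) ` F y) < e)"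
    if x: "x \<in> S" and e: "e > 0" for x e
  proof -
    obtain U where U: "openin (top_of_set S) U" "x \<in> U"
      "\<And>y. y \<in> U \<Longrightarrow> hausdorff_dist \<nu> (F x) (F y) < e / 2"
      using F x e unfolding continuous_map_into_hausdorff_topology[OF N]
      by (metis half_gt_zero topspace_euclidean_subtopology)
    \<comment> \<open>\<open>M + 1\<close> instead of \<open>M\<close> keeps the denominator positive.\<close>
    let ?V = "S \<inter> u -` ball (u x) (e / (2 * (M + 1)))"
    have V: "openin (top_of_set S) ?V"
      using u(1) by (intro continuous_openin_preimage_gen) auto
    have "hausdorff_dist \<nu> ((+) (u x) ` F x) ((+) (u y) ` F y) < e" if y: "y \<in> U \<inter> ?V" for y
    proof -
      have yS: "y \<in> S" using y by auto
      have "\<nu> (u x - u y) \<le> M * dist (u x) (u y)"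
        unfolding dist_norm by (intro M(2) H0_diff uH x yS)
      also have "\<dots> \<le> (M + 1) * dist (u x) (u y)"
        by (simp add: distrib_right)
      also have "\<dots> < e / 2"
        using y M(1) by (simp add: field_simps)
      finally have "\<nu> (u x - u y) < e / 2" .
      moreover have "hausdorff_dist \<nu> ((+) (u x) ` F x) ((+) (u y) ` F y)
          \<le> hausdorff_dist \<nu> (F x) (F y) + \<nu> (u x - u y)"
        by (intro hausdorff_dist_translate_both_le[OF N] FC uH x yS)
      ultimately show ?thesis
        using U(3)[of y] y by auto
    qed
    moreover have "x \<in> ?V"
      using x e M(1) by simp
    ultimately show ?thesis
      using U V by (intro exI[of _ "U \<inter> ?V"]) auto
  qed
  then show ?thesis
    using FC uH by (auto simp: continuous_map_into_hausdorff_topology[OF N] intro: compacts_translate)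
qed

text \<open>
  Closures in \<open>H0\<close> are Euclidean closures, so the agreement of two continuous set-valued maps
  on a set passes to its Euclidean limit points. It is used with \<open>S = L\<close> at \<open>0\<close> and with the group
  generated by \<open>L\<close>.
\<close>

lemma hausdorff_continuous_eq_on_closure:
  assumes "norm_on H0 \<nu>" "S \<subseteq> H0" "z \<in> closure S" "z \<in> H0"
    and "continuous_map (top_of_set H0) (hausdorff_topology \<nu>) f"
    and "continuous_map (top_of_set H0) (hausdorff_topology \<nu>) g"
    and "\<And>s. s \<in> S \<Longrightarrow> f s = g s"
  shows "f z = g z"
proof (rule forall_in_closure_of_eq[where X = "top_of_set H0" and S = S and f = f and g = g])
  show "z \<in> top_of_set H0 closure_of S"
    using assms(2-4) by (simp add: closure_of_subtopology Int_absorb1)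
qed (use assms Hausdorff_space_hausdorff_topology in auto)

section \<open>The closed group generated by the increments\<close>

lemma group_closure_subset_H0:
  assumes "L \<subseteq> H0"
  shows "group_closure L \<subseteq> H0"
proof
  show "x \<in> H0" if "x \<in> group_closure L" for x
    using that by induction (use assms in \<open>auto simp: H0_zero intro: H0_diff\<close>)
qed

lemma closed_group_subset_H0: "L \<subseteq> H0 \<Longrightarrow> closed_group L \<subseteq> H0"
  unfolding closed_group_def by (intro closure_minimal group_closure_subset_H0 closed_H0)

lemma subset_closed_group: "L \<subseteq> closed_group L"
  unfolding closed_group_def
  using closure_subset[of "group_closure L"] by (auto intro: group_closure.base)

lemma zero_in_closed_group: "0 \<in> closed_group L"
  unfolding closed_group_def using closure_subset zero_in_group_closure by blast

lemma closed_group_diff: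
  assumes "g \<in> closed_group L" "h \<in> closed_group L"
  shows "g - h \<in> closed_group L"
proof -
  obtain s t where "\<And>n. s n \<in> group_closure L" "s \<longlonglongrightarrow> g" "\<And>n. t n \<in> group_closure L" "t \<longlonglongrightarrow> h"
    using assms unfolding closed_group_def closure_sequential by blast
  then show ?thesis
    unfolding closed_group_def closure_sequential
    by (intro exI[of _ "\<lambda>n. s n - t n"]) (auto intro: tendsto_diff group_closure.diff)
qed

lemma closed_group_uminus: "g \<in> closed_group L \<Longrightarrow> - g \<in> closed_group L"
  using closed_group_diff[OF zero_in_closed_group] by fastforce

lemma closed_group_add: "g \<in> closed_group L \<Longrightarrow> h \<in> closed_group L \<Longrightarrow> g + h \<in> closed_group L"
  using closed_group_diff[OF _ closed_group_uminus] by fastforce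

lemma quot_proj_add:
  assumes "g \<in> closed_group L"
  shows "quot_proj L (x + g) = quot_proj L x"
proof -
  have le: "quot_proj L (x + g) \<subseteq> quot_proj L x" if "g \<in> closed_group L" for x g
    using that by (auto simp: quot_proj_def add.assoc intro: closed_group_add)
  show ?thesis
    using le[OF assms, of x] le[OF closed_group_uminus[OF assms], of "x + g"] by auto
qed

lemma quot_proj_eqD:
  assumes "quot_proj L x = quot_proj L y"
  obtains g where "g \<in> closed_group L" "y = x + g"
proof -
  have "y + 0 \<in> quot_proj L y"
    unfolding quot_proj_def using zero_in_closed_group by blast
  then show thesis
    using that assms by (auto simp: quot_proj_def)
qed

section \<open>Compatible families come from the quotient\<close>

lemma Psi_continuous:
  "continuous_family \<nu> \<Phi> \<Longrightarrow> continuous_map (top_of_set H0) (hausdorff_topology \<nu>) (Psi \<Phi> t)"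
  by (simp add: continuous_family_def)

lemma Psi_in_compacts:
  assumes "norm_on H0 \<nu>" "continuous_family \<nu> \<Phi>" "x \<in> H0"
  shows "Psi \<Phi> t x \<in> compacts"
proof -
  have "Psi \<Phi> t \<in> topspace (top_of_set H0) \<rightarrow> topspace (hausdorff_topology \<nu>)"
    by (rule continuous_map_funspace[OF Psi_continuous[OF assms(2)]])
  then show ?thesis
    using assms(3) by (simp add: Pi_iff topspace_hausdorff_topology[OF assms(1)])
qed

lemma compatibleD:
  assumes "compatible L \<Phi>" "x \<in> H0" "l \<in> L"
  shows "Psi \<Phi> (Suc t) (x + l) = (+) l ` Psi \<Phi> t x"
proof -
  have "Psi \<Phi> (Suc t) (x + l) = (\<lambda>y. y + l) ` Psi \<Phi> t x"
    using assms by (simp add: compatible_def)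
  also have "\<dots> = (+) l ` Psi \<Phi> t x"
    by (intro image_cong) (simp_all add: add.commute)
  finally show ?thesis .
qed

text \<open>
  Increments \<open>l\<close> tending to \<open>0\<close> turn the compatibility relation between consecutive times into
  equality.
\<close>

lemma Psi_time_independent:
  fixes L :: "(real ^ 'n) set"
  assumes N: "norm_on H0 \<nu>" and L: "L \<subseteq> H0" "0 \<in> closure L"
    and \<Phi>: "continuous_family \<nu> \<Phi>" "compatible L \<Phi>" and x: "x \<in> H0"
  shows "Psi \<Phi> t x = Psi \<Phi> 0 x"
proof -
  have step: "Psi \<Phi> (Suc t) x = Psi \<Phi> t x" for t
  proof -
    have "Psi \<Phi> (Suc t) (x + 0) = (+) 0 ` Psi \<Phi> t x"
    proof (rule hausdorff_continuous_eq_on_closure[OF N L H0_zero,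
          where f = "\<lambda>l. Psi \<Phi> (Suc t) (x + l)" and g = "\<lambda>l. (+) l ` Psi \<Phi> t x"])
      have "continuous_map (top_of_set H0) (top_of_set H0) (\<lambda>l. x + l)"
        using H0_add[OF x] by (auto intro!: continuous_intros)
      from continuous_map_compose[OF this Psi_continuous[OF \<Phi>(1)]]
      show "continuous_map (top_of_set H0) (hausdorff_topology \<nu>) (\<lambda>l. Psi \<Phi> (Suc t) (x + l))"
        by (simp add: o_def)
      show "continuous_map (top_of_set H0) (hausdorff_topology \<nu>) (\<lambda>l. (+) l ` Psi \<Phi> t x)"
        using Psi_in_compacts[OF N \<Phi>(1) x]
        by (intro continuous_map_translate[OF N]) (auto simp: topspace_hausdorff_topology[OF N])
    qed (rule compatibleD[OF \<Phi>(2) x])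
    then show ?thesis by simp
  qed
  show ?thesis
    by (induction t) (simp_all add: step)
qed

text \<open>
  The residual of a periodic rule is invariant under the group generated by the periods because
  periods can be subtracted, and under its closure because translation is continuous.
\<close>

lemma closed_group_period:
  fixes L :: "(real ^ 'n) set"
  assumes N: "norm_on H0 \<nu>" and L: "L \<subseteq> H0"
    and E: "continuous_map (top_of_set H0) (hausdorff_topology \<nu>) E"
    and period: "\<And>x l. x \<in> H0 \<Longrightarrow> l \<in> L \<Longrightarrow> E (x + l) = E x"
    and x: "x \<in> H0" and g: "g \<in> closed_group L"
  shows "E (x + g) = E x"
proof (rule hausdorff_continuous_eq_on_closure[OF N group_closure_subset_H0[OF L],
      where f = "\<lambda>h. E (x + h)" and g = "\<lambda>_. E x"])
  show "g \<in> closure (group_closure L)" "g \<in> H0"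
    using g closed_group_subset_H0[OF L] by (auto simp: closed_group_def)
  have "continuous_map (top_of_set H0) (top_of_set H0) (\<lambda>h. x + h)"
    using H0_add[OF x] by (auto intro!: continuous_intros)
  from continuous_map_compose[OF this E]
  show "continuous_map (top_of_set H0) (hausdorff_topology \<nu>) (\<lambda>h. E (x + h))"
    by (simp add: o_def)
  show "continuous_map (top_of_set H0) (hausdorff_topology \<nu>) (\<lambda>h. E x)"
    using E x by (auto simp: continuous_map_into_hausdorff_topology[OF N]
        topspace_hausdorff_topology[OF N])
  show "E (x + s) = E x" if "s \<in> group_closure L" for s
    using that x
  proof (induction arbitrary: x)
    case (base s)
    then show ?case using period by auto
  next
    case (diff s t)
    \<comment> \<open>Shifting the base point to \<open>x - t\<close> reduces \<open>E (x + (s - t)) = E x\<close> to the two hypotheses there.\<close>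
    have "x - t \<in> H0"
      using diff group_closure_subset_H0[OF L] by (auto intro: H0_diff)
    then have "E ((x - t) + s) = E ((x - t) + t)"
      using diff.IH by metis
    then show ?case by (simp add: algebra_simps)
  qed
qed

lemma compatible_imp_represents:
  fixes L :: "(real ^ 'n) set"
  assumes N: "norm_on H0 \<nu>" and L: "L \<subseteq> H0" "0 \<in> closure L"
    and \<Phi>: "continuous_family \<nu> \<Phi>" "compatible L \<Phi>"
  obtains C where "represents L \<nu> \<Phi> C"
proof -
  define E where "E x = (+) (- x) ` Psi \<Phi> 0 x" for x
  have contE: "continuous_map (top_of_set H0) (hausdorff_topology \<nu>) E"
    unfolding E_def
    by (intro continuous_map_translate[OF N] Psi_continuous[OF \<Phi>(1)] continuous_intros)
       (auto intro: H0_uminus)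
  have period: "E (x + l) = E x" if "x \<in> H0" "l \<in> L" for x l
  proof -
    have "Psi \<Phi> 0 (x + l) = Psi \<Phi> (Suc 0) (x + l)"
      using that L H0_add by (intro Psi_time_independent[OF N L \<Phi>, symmetric]) auto
    also have "\<dots> = (+) l ` Psi \<Phi> 0 x"
      by (rule compatibleD[OF \<Phi>(2) that])
    finally show ?thesis
      by (simp add: E_def image_image)
  qed
  have "E x = E y" if "x \<in> H0" "quot_proj L x = quot_proj L y" for x y
    using that closed_group_period[OF N L(1) contE period] by (metis quot_proj_eqD)
  then obtain D where D: "continuous_map (quot_topology L) (hausdorff_topology \<nu>) D"
    "\<And>x. x \<in> H0 \<Longrightarrow> D (quot_proj L x) = E x"
    using quotient_map_lift_exists[OF quotient_map_quot_proj contE]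
    by (metis topspace_euclidean_subtopology)
  have "represents L \<nu> \<Phi> (restrict D (quot_proj L ` H0))"
    unfolding represents_def
  proof (intro conjI allI ballI)
    show "continuous_map (quot_topology L) (hausdorff_topology \<nu>) (restrict D (quot_proj L ` H0))"
      by (rule continuous_map_eq[OF D(1)]) (simp add: topspace_quot_topology)
    show "Psi \<Phi> t x = (\<lambda>c. x + c) ` restrict D (quot_proj L ` H0) (quot_proj L x)"
      if "x \<in> H0" for t x
      using that D(2) Psi_time_independent[OF N L \<Phi> that, of t] by (simp add: E_def image_image)
  qed simp
  then show thesis by (rule that)
qed

lemma representsD:
  assumes "represents L \<nu> \<Phi> C"
  shows "C \<in> extensional (quot_proj L ` H0)"
    and "continuous_map (quot_topology L) (hausdorff_topology \<nu>) C"
    and "x \<in> H0 \<Longrightarrow> Psi \<Phi> t x = (+) x ` C (quot_proj L x)"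
  using assms unfolding represents_def by blast+

lemma represents_unique:
  assumes "represents L \<nu> \<Phi> C" "represents L \<nu> \<Phi> D"
  shows "C = D"
proof (rule extensionalityI)
  show "C \<in> extensional (quot_proj L ` H0)" "D \<in> extensional (quot_proj L ` H0)"
    using assms by (blast dest: representsD(1))+
  fix q assume "q \<in> quot_proj L ` H0"
  then obtain x where x: "x \<in> H0" "q = quot_proj L x" by blast
  then have "(+) x ` C q = (+) x ` D q"
    using representsD(3)[OF assms(1)] representsD(3)[OF assms(2)] by metis
  then show "C q = D q"
    by (rule inj_image_eq_iff[OF inj_on_add, THEN iffD1])
qed

lemma represents_imp_compatible:
  fixes L :: "(real ^ 'n) set"
  assumes L: "L \<subseteq> H0" and C: "represents L \<nu> \<Phi> C"
  shows "compatible L \<Phi>"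
  unfolding compatible_def
proof (intro allI ballI)
  fix t l and x :: "real ^ 'n" assume x: "x \<in> H0" and l: "l \<in> L"
  have "x + l \<in> H0"
    using x l L by (auto intro: H0_add)
  then have "Psi \<Phi> (Suc t) (x + l) = (+) (x + l) ` C (quot_proj L (x + l))"
    by (rule representsD(3)[OF C])
  also have "quot_proj L (x + l) = quot_proj L x"
    by (rule quot_proj_add[OF subsetD[OF subset_closed_group l]])
  also have "(+) (x + l) ` C (quot_proj L x) = (\<lambda>y. y + l) ` (+) x ` C (quot_proj L x)"
    by (simp add: image_image add_ac)
  also have "(+) x ` C (quot_proj L x) = Psi \<Phi> t x"
    by (rule representsD(3)[OF C x, symmetric])
  finally show "Psi \<Phi> (Suc t) (x + l) = (\<lambda>y. y + l) ` Psi \<Phi> t x" .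
qed

section \<open>Consistency anchors\<close>

text \<open>
  The representation makes \<open>\<Psi>\<close> the same map at all times, so the anchor condition is about values
  of one continuous map along a convergent sequence; limits in the Hausdorff metric are unique.
\<close>

lemma anchor_value:
  assumes N: "norm_on H0 \<nu>" and \<Phi>: "continuous_family \<nu> \<Phi>" and C: "represents L \<nu> \<Phi> C"
    and a: "a \<in> H0" "consistency_anchor \<nu> \<Phi> a"
  shows "C (quot_proj L a) = {0}"
proof -
  interpret Metric_space compacts "hausdorff_dist \<nu>"
    by (rule Metric_space_hausdorff_dist[OF N])
  obtain X where X: "\<And>t. X t \<in> H0" "X \<longlonglongrightarrow> a"
    "(\<lambda>t. hausdorff_dist \<nu> (Psi \<Phi> t (X t)) {a}) \<longlonglongrightarrow> 0"
    using a(2) unfolding consistency_anchor_def by blast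
  have time: "Psi \<Phi> t (X t) = Psi \<Phi> 0 (X t)" for t
    using representsD(3)[OF C X(1)] by metis
  have "limitin (top_of_set H0) X a sequentially"
    using X a by (auto simp: limitin_subtopology)
  then have "limitin mtopology (Psi \<Phi> 0 \<circ> X) (Psi \<Phi> 0 a) sequentially"
    using continuous_map_limit[OF Psi_continuous[OF \<Phi>, of 0]] by (simp add: hausdorff_topology_def)
  moreover have "limitin mtopology (Psi \<Phi> 0 \<circ> X) {a} sequentially"
    using X a(1) Psi_in_compacts[OF N \<Phi>]
    by (simp add: limitin_metric_dist_null singleton_in_compacts time o_def)
  ultimately have "Psi \<Phi> 0 a = {a}"
    by (rule limitin_metric_unique) simp
  then have "(+) a ` C (quot_proj L a) = (+) a ` {0}"
    using representsD(3)[OF C a(1), of 0] by simp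
  then show ?thesis
    by (rule inj_image_eq_iff[OF inj_on_add, THEN iffD1])
qed

lemma dense_anchors_force_singleton:
  fixes L :: "(real ^ 'n) set"
  assumes N: "norm_on H0 \<nu>" and L: "L \<subseteq> H0" "0 \<in> closure L"
    and A: "A \<subseteq> H0" and dense: "quot_topology L closure_of (quot_proj L ` A) = quot_proj L ` H0"
    and \<Phi>: "continuous_family \<nu> \<Phi>" "compatible L \<Phi>"
    and anchors: "\<And>a. a \<in> A \<Longrightarrow> consistency_anchor \<nu> \<Phi> a"
    and x: "x \<in> H0"
  shows "Psi \<Phi> t x = {x}"
proof -
  obtain C where C: "represents L \<nu> \<Phi> C"
    using compatible_imp_represents[OF N L \<Phi>] .
  have "C (quot_proj L x) = (\<lambda>_. {0}) (quot_proj L x)"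
  proof (rule forall_in_closure_of_eq[where f = C and g = "\<lambda>_. {0}"])
    show "quot_proj L x \<in> quot_topology L closure_of (quot_proj L ` A)"
      using dense x by simp
    show "continuous_map (quot_topology L) (hausdorff_topology \<nu>) C"
      by (rule representsD(2)[OF C])
    show "continuous_map (quot_topology L) (hausdorff_topology \<nu>) (\<lambda>_. {0})"
      by (simp add: topspace_hausdorff_topology[OF N] singleton_in_compacts H0_zero)
    show "C q = {0}" if "q \<in> quot_proj L ` A" for q
      using that A anchors anchor_value[OF N \<Phi>(1) C] by auto
  qed (rule Hausdorff_space_hausdorff_topology[OF N])
  then show ?thesis
    using representsD(3)[OF C x] by simp
qed

lemma infdist_closed_group_add:
  assumes "g \<in> closed_group L"
  shows "infdist (y + g) (closed_group L) = infdist y (closed_group L)"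
proof -
  have ne: "closed_group L \<noteq> {}"
    using zero_in_closed_group by blast
  have le: "infdist (y + g) (closed_group L) \<le> infdist y (closed_group L)"
    if "g \<in> closed_group L" for y g
    unfolding infdist_notempty[OF ne, of y]
  proof (rule cINF_greatest[OF ne])
    fix h assume "h \<in> closed_group L"
    then have "infdist (y + g) (closed_group L) \<le> dist (y + g) (h + g)"
      using that by (intro infdist_le closed_group_add)
    then show "infdist (y + g) (closed_group L) \<le> dist y h" by simp
  qed
  show ?thesis
    using le[OF assms, of y] le[OF closed_group_uminus[OF assms], of "y + g"] by simp
qed

text \<open>
  A neighbourhood of \<open>\<pi> x\<^sub>0\<close> missing \<open>\<pi>(A)\<close> pulls back to a \<open>G\<close>-invariant open set, so the distance
  from a point of \<open>A\<close> to the whole coset of \<open>x\<^sub>0\<close>, and not merely to \<open>x\<^sub>0\<close>, is bounded below.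
\<close>

lemma positive_distance_to_coset:
  fixes L :: "(real ^ 'n) set"
  assumes L: "L \<subseteq> H0" and A: "A \<subseteq> H0" and x0: "x0 \<in> H0"
    and off: "quot_proj L x0 \<notin> quot_topology L closure_of (quot_proj L ` A)"
  obtains r where "r > 0" "\<And>a. a \<in> A \<Longrightarrow> r \<le> infdist (a - x0) (closed_group L)"
proof -
  obtain U where U: "openin (quot_topology L) U" "quot_proj L x0 \<in> U" "U \<inter> quot_proj L ` A = {}"
    using off x0 unfolding in_closure_of topspace_quot_topology by blast
  have "openin (top_of_set H0) {x \<in> H0. quot_proj L x \<in> U}"
    using U(1) by (simp add: openin_quot_topology)
  then obtain r where r: "r > 0" "ball x0 r \<inter> H0 \<subseteq> {x \<in> H0. quot_proj L x \<in> U}"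
    using U(2) x0 unfolding openin_contains_ball by blast
  have ne: "closed_group L \<noteq> {}"
    using zero_in_closed_group by blast
  have "r \<le> infdist (a - x0) (closed_group L)" if a: "a \<in> A" for a
    unfolding infdist_notempty[OF ne]
  proof (rule cINF_greatest[OF ne], rule ccontr)
    fix g assume g: "g \<in> closed_group L" and "\<not> r \<le> dist (a - x0) g"
    then have "a - g \<in> ball x0 r"
      by (simp add: dist_norm norm_minus_commute algebra_simps)
    moreover have "a - g \<in> H0"
      using a A g closed_group_subset_H0[OF L] by (auto intro: H0_diff)
    ultimately have "quot_proj L (a - g) \<in> U"
      using r(2) by blast
    moreover have "quot_proj L (a - g) = quot_proj L a"
      using quot_proj_add[OF g, of "a - g"] by simp
    ultimately show False
      using U(3) a by auto
  qed
  then show thesis using r(1) that by blast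
qed

text \<open>
  The displacement along \<open>v\<close> by the bump \<open>f\<close> of the coset of \<open>x\<^sub>0\<close>: the bump is supported within
  distance \<open>r\<close> of that coset, hence vanishes on \<open>A\<close>, and it is \<open>G\<close>-periodic because it measures
  distance to a coset of \<open>G\<close>. Each point of \<open>A\<close> is then an anchor through a constant sequence.
\<close>

lemma nontrivial_family_off_closure:
  fixes L :: "(real ^ 'n) set" and \<nu> :: "real ^ 'n \<Rightarrow> real"
  assumes card: "CARD('n) \<ge> 2" and N: "norm_on H0 \<nu>" and L: "L \<subseteq> H0" and A: "A \<subseteq> H0"
    and x0: "x0 \<in> H0"
    and off: "quot_proj L x0 \<notin> quot_topology L closure_of (quot_proj L ` A)"
  obtains \<Phi> where "continuous_family \<nu> \<Phi>" "compatible L \<Phi>"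
    "\<And>a. a \<in> A \<Longrightarrow> consistency_anchor \<nu> \<Phi> a" "Psi \<Phi> 0 x0 \<noteq> {x0}"
proof -
  obtain v :: "real ^ 'n" where v: "v \<in> H0" "v \<noteq> 0"
    using H0_nonzero[OF card] .
  obtain r where r: "r > 0" "\<And>a. a \<in> A \<Longrightarrow> r \<le> infdist (a - x0) (closed_group L)"
    using positive_distance_to_coset[OF L A x0 off] by blast
  define f where "f x = max 0 (r - infdist (x - x0) (closed_group L))" for x
  have contf: "continuous_on H0 f"
    unfolding f_def by (intro continuous_intros)
  have f_A: "f a = 0" if "a \<in> A" for a
    using r(2)[OF that] by (simp add: f_def)
  have f_x0: "f x0 = r"
    using r(1) infdist_zero[OF zero_in_closed_group, of L] by (simp add: f_def)
  have f_period: "f (x + l) = f x" if "l \<in> L" for x l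
    using infdist_closed_group_add[OF subsetD[OF subset_closed_group that], of "x - x0"]
    by (simp add: f_def algebra_simps)
  define P where "P x = {x + f x *\<^sub>R v}" for x
  define \<Phi> where "\<Phi> = (\<lambda>(t::nat) p. softmax ` P (clr p))"
  have P_sub: "P x \<subseteq> H0" if "x \<in> H0" for x
    using that v by (simp add: P_def H0_add H0_scaleR)
  have Psi: "Psi \<Phi> t x = P x" if "x \<in> H0" for t x
    unfolding \<Phi>_def using that P_sub by (intro Psi_of_coordinates)
  have "continuous_map (top_of_set H0) (hausdorff_topology \<nu>) (\<lambda>x. (+) (x + f x *\<^sub>R v) ` {0})"
    using v contf
    by (intro continuous_map_translate[OF N] continuous_intros)
       (auto simp: topspace_hausdorff_topology[OF N] singleton_in_compacts H0_zero H0_add H0_scaleR)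
  then have "continuous_map (top_of_set H0) (hausdorff_topology \<nu>) (Psi \<Phi> t)" for t
    by (rule continuous_map_eq) (simp add: Psi P_def)
  then have "continuous_family \<nu> \<Phi>"
    by (auto simp: continuous_family_def \<Phi>_def P_def softmax_in_open_simplex)
  moreover have "compatible L \<Phi>"
    unfolding compatible_def
  proof (intro allI ballI)
    fix t l and x :: "real ^ 'n" assume x: "x \<in> H0" and l: "l \<in> L"
    have "x + l \<in> H0"
      using x l L by (auto intro: H0_add)
    then show "Psi \<Phi> (Suc t) (x + l) = (\<lambda>y. y + l) ` Psi \<Phi> t x"
      using x f_period[OF l, of x] by (simp add: Psi P_def algebra_simps)
  qed
  moreover have "consistency_anchor \<nu> \<Phi> a" if "a \<in> A" for a
  proof -
    have a: "a \<in> H0" using that A by blast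
    interpret Metric_space compacts "hausdorff_dist \<nu>"
      by (rule Metric_space_hausdorff_dist[OF N])
    have "hausdorff_dist \<nu> (Psi \<Phi> t a) {a} = 0" for t
      using a f_A[OF that] by (simp add: Psi P_def singleton_in_compacts)
    then show ?thesis
      unfolding consistency_anchor_def using a by (intro exI[of _ "\<lambda>_. a"]) auto
  qed
  moreover have "Psi \<Phi> 0 x0 \<noteq> {x0}"
    using x0 v(2) f_x0 r(1) by (simp add: Psi P_def)
  ultimately show thesis by (rule that)
qed

section \<open>Compatibility, anchors and the singleton constructor\<close>

theorem theorem3p7:
  fixes L :: "(real ^ 'n) set" and \<nu> :: "real ^ 'n \<Rightarrow> real"
  assumes "CARD('n) \<ge> 2"
    and "norm_on H0 \<nu>"
    and "L \<subseteq> H0"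
    and "0 \<in> closure L"
  shows
    "(\<forall>\<Phi>. continuous_family \<nu> \<Phi> \<longrightarrow>
        (compatible L \<Phi> \<longleftrightarrow> (\<exists>!C. represents L \<nu> \<Phi> C))) \<and>
     (\<forall>\<Phi> A C. continuous_family \<nu> \<Phi> \<and> compatible L \<Phi> \<and> represents L \<nu> \<Phi> C \<and>
        A \<subseteq> H0 \<and> (\<forall>a\<in>A. consistency_anchor \<nu> \<Phi> a) \<longrightarrow>
        (\<forall>a\<in>A. C (quot_proj L a) = {0})) \<and>
     (\<forall>A. A \<subseteq> H0 \<longrightarrow>
        ((\<forall>\<Phi>. continuous_family \<nu> \<Phi> \<and> compatible L \<Phi> \<and>
              (\<forall>a\<in>A. consistency_anchor \<nu> \<Phi> a) \<longrightarrow>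
              (\<forall>t. \<forall>x\<in>H0. Psi \<Phi> t x = {x}))
         \<longleftrightarrow> quot_topology L closure_of (quot_proj L ` A) = quot_proj L ` H0))"
proof (intro conjI allI impI)
  fix \<Phi>
  assume "continuous_family \<nu> \<Phi>"
  then show "compatible L \<Phi> \<longleftrightarrow> (\<exists>!C. represents L \<nu> \<Phi> C)"
    using compatible_imp_represents[OF assms(2-4)] represents_unique
      represents_imp_compatible[OF assms(3)] by metis
next
  fix \<Phi> A C
  assume "continuous_family \<nu> \<Phi> \<and> compatible L \<Phi> \<and> represents L \<nu> \<Phi> C \<and>
    A \<subseteq> H0 \<and> (\<forall>a\<in>A. consistency_anchor \<nu> \<Phi> a)"
  then show "\<forall>a\<in>A. C (quot_proj L a) = {0}"
    using anchor_value[OF assms(2)] by blast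
next
  fix A :: "(real ^ 'n) set"
  assume A: "A \<subseteq> H0"
  let ?forced = "\<forall>\<Phi>. continuous_family \<nu> \<Phi> \<and> compatible L \<Phi> \<and>
      (\<forall>a\<in>A. consistency_anchor \<nu> \<Phi> a) \<longrightarrow> (\<forall>t. \<forall>x\<in>H0. Psi \<Phi> t x = {x})"
  show "?forced \<longleftrightarrow> quot_topology L closure_of (quot_proj L ` A) = quot_proj L ` H0"
  proof
    assume forced: ?forced
    have "quot_proj L x \<in> quot_topology L closure_of (quot_proj L ` A)" if "x \<in> H0" for x
      using nontrivial_family_off_closure[OF assms(1-3) A that] forced that by metis
    then show "quot_topology L closure_of (quot_proj L ` A) = quot_proj L ` H0"
      using closure_of_subset_topspace[of "quot_topology L"] topspace_quot_topology by blast
  next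
    assume "quot_topology L closure_of (quot_proj L ` A) = quot_proj L ` H0"
    then show ?forced
      using dense_anchors_force_singleton[OF assms(2-4) A] by blast
  qed
qed

end
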